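(* Let $(\bar x,\bar y)\in S^o_{\rm Lag}(\bar p)$, where $\bar p=(\bar w,0,0)$. Let $f_\nu:\mathbb R^n\times\mathbb R^d\to\mathbb R$ ($\nu=1,\dots,N$) and $F:\mathbb R^n\times\mathbb R^d\to\mathbb R^m$ be twice differentiable with respect to $x$ in a neighborhood of $(\bar x,\bar w)$, and suppose that $f_\nu$, $F$, $\nabla_xf_\nu$ and $\mathcal J_xF$ are strictly differentiable with respect to $(x,w)$ in this neighborhood. Then $S^o_{\rm Lag}$ has the isolated calmness property at $\bar p$ for $(\bar x,\bar y)$ if and only if the following implication holds for $d_x\in\mathbb R^n$, $[d_y]_\alpha\in\mathbb R^{|\alpha|}$, $[d_y]_\beta\in\mathbb R^{|\beta|}$: $$\left.\begin{array}{l}\mathbf Gd_x+\mathcal Jg_\alpha(\bar x)^T[d_y]_\alpha+\mathcal Jg_\beta(\bar x)^T[d_y]_\beta=0\\ \mathcal Jg_\alpha(\bar x)d_x=0\\ 0\ge\mathcal Jg_\beta(\bar x)d_x\perp[d_y]_\beta\ge0\end{array}\right\}\Longrightarrow d_x=0,\ [d_y]_{\alpha\cup\beta}=0.$$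
   Context: **Setting (shared equality and inequality constraints).** There are $N$ players, $n=n_1+\dots+n_N$, $x=(x^1,\dots,x^N)\in\mathbb R^n$ with $x^\nu\in\mathbb R^{n_\nu}$, and $x^{-\nu}$ denotes the other blocks. $K=\{0_q\}\times\mathbb R_-^{m-q}\subset\mathbb R^m$, with polar $K^\circ=\mathbb R^q\times\mathbb R_+^{m-q}$. Given $p=(w,v,u)\in\mathbb R^d\times\mathbb R^n\times\mathbb R^m$, player $\nu$ minimizes $f_\nu(x^\nu,x^{-\nu};w)-\langle v^\nu,x^\nu\rangle$ over $x^\nu\in\mathbb R^{n_\nu}$ subject to $F(x^\nu,x^{-\nu};w)-u\in K$. The set of consensus Lagrangian generalized Nash equilibria (common multiplier $y$) is $$S^o_{\rm Lag}(p)=\{(x,y)\in\mathbb R^n\times\mathbb R^m:\ \nabla_{x^\nu}f_\nu(x;w)+\mathcal J_{x^\nu}F(x;w)^Ty-v^\nu=0,\ \nu=1,\dots,N,\ \ 0\in-F(x;w)+u+N_{K^\circ}(y)\},$$ with $N_C$ the normal cone of convex analysis and $\mathcal J$ the Jacobian. **Notation.** Fix $\bar w\in\mathbb R^d$; $\theta_\nu=f_\nu(\cdot;\bar w)$, $g=F(\cdot;\bar w)$, $l_\nu(x,y)=\theta_\nu(x)+\langle y,g(x)\rangle$. $\mathbf G$ is the $n\times n$ matrix with $(\nu,\mu)$ block $\nabla^2_{x^\nu x^\mu}l_\nu(\bar x,\bar y)$ (derivative in $x^\mu$ of $\nabla_{x^\nu}l_\nu$). Index sets: $\alpha=\{1,\dots,q\}\cup\{i\in\{q+1,\dots,m\}:g_i(\bar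 x)=0<\bar y_i\}$, $\beta=\{i\in\{q+1,\dots,m\}:g_i(\bar x)=0=\bar y_i\}$. $g_I$ is the subvector of $g$ with indices in $I$. $0\ge a\perp b\ge0$ means $a\le0$, $b\ge0$ componentwise and $\langle a,b\rangle=0$. **Isolated calmness.** A set-valued $S$ has the isolated calmness property at $\bar a$ for $\bar b\in S(\bar a)$ if there are $\kappa>0$ and neighborhoods $V$ of $\bar a$, $W$ of $\bar b$ with $S(a)\cap W\subset\{\bar b\}+\kappa\|a-\bar a\|\mathbf B$ for all $a\in V$ ($\mathbf B$ the closed unit ball). *)

theory Defs
  imports "HOL-Analysis.Analysis"
begin

subsection \<open>Derivatives\<close>

definition gradient :: "(real^'n::finite \<Rightarrow> real) \<Rightarrow> real^'n \<Rightarrow> real^'n" where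
  "gradient h x = (\<chi> i. frechet_derivative h (at x) (axis i 1))"

definition hessian :: "(real^'n::finite \<Rightarrow> real) \<Rightarrow> real^'n \<Rightarrow> real^'n^'n" where
  "hessian h x = jacobian (gradient h) (at x)"

definition gradient_x :: "((real^'n::finite) \<times> 'w \<Rightarrow> real) \<Rightarrow> (real^'n) \<times> 'w \<Rightarrow> real^'n" where
  "gradient_x h = (\<lambda>(x, w). gradient (\<lambda>x'. h (x', w)) x)"

definition jacobian_x ::
  "((real^'n::finite) \<times> 'w \<Rightarrow> real^'m::finite) \<Rightarrow> (real^'n) \<times> 'w \<Rightarrow> real^'n^'m" where
  "jacobian_x H = (\<lambda>(x, w). jacobian (\<lambda>x'. H (x', w)) (at x))"

definition strictly_differentiable_at ::
  "('a::real_normed_vector \<Rightarrow> 'b::real_normed_vector) \<Rightarrow> 'a \<Rightarrow> bool" where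
  "strictly_differentiable_at h a \<longleftrightarrow>
     (\<exists>A. bounded_linear A \<and>
       (\<forall>e>0. \<exists>\<delta>>0. \<forall>s\<in>ball a \<delta>. \<forall>t\<in>ball a \<delta>.
          norm (h s - h t - A (s - t)) \<le> e * norm (s - t)))"

subsection \<open>Convex cones and isolated calmness\<close>

definition polar_cone :: "'a::real_inner set \<Rightarrow> 'a set" where
  "polar_cone C = {y. \<forall>z\<in>C. y \<bullet> z \<le> 0}"

definition normal_cone :: "'a::real_inner set \<Rightarrow> 'a \<Rightarrow> 'a set" where
  "normal_cone C y = (if y \<in> C then {v. \<forall>z\<in>C. v \<bullet> (z - y) \<le> 0} else {})"

definition isolated_calmness ::
  "('a::real_normed_vector \<Rightarrow> 'b::real_normed_vector set) \<Rightarrow> 'a \<Rightarrow> 'b \<Rightarrow> bool" where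
  "isolated_calmness S a b \<longleftrightarrow>
     (\<exists>\<kappa>>0. \<exists>V W. open V \<and> a \<in> V \<and> open W \<and> b \<in> W \<and>
       (\<forall>a'\<in>V. S a' \<inter> W \<subseteq> cball b (\<kappa> * norm (a' - a))))"

subsection \<open>The game\<close>

text \<open>
  The coordinates of \<open>x\<close> are indexed by a finite type \<open>'n\<close>, and \<open>owner i\<close> is the player
  controlling coordinate \<open>i\<close>; thus the block of player \<open>\<nu>\<close> consists of the coordinates in
  \<open>owner -` {\<nu>}\<close>, and a partial gradient in that block is the corresponding subvector of the
  full gradient. The set \<open>E\<close> collects the equality constraints; it takes the place of
  \<open>{1, ..., q}\<close>, and its complement that of \<open>{q+1, ..., m}\<close>.
\<close>

definition constraint_cone :: "'m::finite set \<Rightarrow> (real^'m) set" where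
  "constraint_cone E = {z. (\<forall>i\<in>E. z $ i = 0) \<and> (\<forall>i\<in>-E. z $ i \<le> 0)}"

lemma polar_constraint_cone:
  fixes E :: "'m::finite set"
  shows "polar_cone (constraint_cone E) = {y. \<forall>i\<in>-E. 0 \<le> y $ i}"
proof (intro set_eqI iffI)
  fix y :: "real^'m" assume y: "y \<in> polar_cone (constraint_cone E)"
  have "0 \<le> y $ i" if "i \<in> - E" for i
  proof -
    have "axis i (-1) \<in> constraint_cone E"
      using that by (auto simp: constraint_cone_def axis_def)
    then have "y \<bullet> axis i (-1) \<le> 0"
      using y by (auto simp: polar_cone_def)
    then show ?thesis by (simp add: inner_axis)
  qed
  then show "y \<in> {y. \<forall>i\<in>-E. 0 \<le> y $ i}" by blast
next
  fix y :: "real^'m" assume y: "y \<in> {y. \<forall>i\<in>-E. 0 \<le> y $ i}"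
  have "y $ i * z $ i \<le> 0" if "z \<in> constraint_cone E" for z :: "real^'m" and i
    using that y by (cases "i \<in> E") (auto simp: constraint_cone_def mult_le_0_iff)
  then show "y \<in> polar_cone (constraint_cone E)"
    by (auto simp: polar_cone_def inner_vec_def intro!: sum_nonpos)
qed

definition S_Lag ::
  "('n::finite \<Rightarrow> 'N) \<Rightarrow> 'm::finite set \<Rightarrow>
   ('N \<Rightarrow> (real^'n) \<times> (real^'d::finite) \<Rightarrow> real) \<Rightarrow>
   ((real^'n) \<times> (real^'d) \<Rightarrow> real^'m) \<Rightarrow>
   (real^'d) \<times> (real^'n) \<times> (real^'m) \<Rightarrow> ((real^'n) \<times> (real^'m)) set" where
  "S_Lag owner E f F = (\<lambda>(w, v, u). {(x, y).
     (\<forall>\<nu>. \<forall>i\<in>owner -` {\<nu>}.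
        gradient_x (f \<nu>) (x, w) $ i + (transpose (jacobian_x F (x, w)) *v y) $ i - v $ i = 0) \<and>
     (\<exists>z\<in>normal_cone (polar_cone (constraint_cone E)) y. 0 = - F (x, w) + u + z)})"

definition lagrangian ::
  "('N \<Rightarrow> real^'n::finite \<Rightarrow> real) \<Rightarrow> (real^'n \<Rightarrow> real^'m::finite) \<Rightarrow>
   'N \<Rightarrow> real^'n \<Rightarrow> real^'m \<Rightarrow> real" where
  "lagrangian \<theta> g \<nu> x y = \<theta> \<nu> x + y \<bullet> g x"

text \<open>Row \<open>i\<close> belongs to the block row of player \<open>owner i\<close>, so the Lagrangian depends on the row.\<close>

definition G_matrix ::
  "('n::finite \<Rightarrow> 'N) \<Rightarrow> ('N \<Rightarrow> real^'n \<Rightarrow> real) \<Rightarrow> (real^'n \<Rightarrow> real^'m::finite) \<Rightarrow>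
   real^'n \<Rightarrow> real^'m \<Rightarrow> real^'n^'n" where
  "G_matrix owner \<theta> g x y =
     (\<chi> i j. hessian (\<lambda>x'. lagrangian \<theta> g (owner i) x' y) x $ i $ j)"

definition alpha_set :: "'m::finite set \<Rightarrow> ('x \<Rightarrow> real^'m) \<Rightarrow> 'x \<Rightarrow> real^'m \<Rightarrow> 'm set" where
  "alpha_set E g x y = E \<union> {i\<in>-E. g x $ i = 0 \<and> 0 < y $ i}"

definition beta_set :: "'m::finite set \<Rightarrow> ('x \<Rightarrow> real^'m) \<Rightarrow> 'x \<Rightarrow> real^'m \<Rightarrow> 'm set" where
  "beta_set E g x y = {i\<in>-E. g x $ i = 0 \<and> y $ i = 0}"

text \<open>
  A subvector with index set \<open>I\<close> is represented by a full vector of which only the components in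
  \<open>I\<close> are used. In this sense, \<open>transpose_rows_mult A I b\<close> is the product of the transpose of the
  submatrix of \<open>A\<close> with row set \<open>I\<close> and the subvector of \<open>b\<close>.
\<close>

definition transpose_rows_mult ::
  "real^'n::finite^'m::finite \<Rightarrow> 'm set \<Rightarrow> real^'m \<Rightarrow> real^'n" where
  "transpose_rows_mult A I b = (\<Sum>i\<in>I. b $ i *\<^sub>R row i A)"

definition complementary_on :: "'m::finite set \<Rightarrow> real^'m \<Rightarrow> real^'m \<Rightarrow> bool" where
  "complementary_on I a b \<longleftrightarrow>
     (\<forall>i\<in>I. a $ i \<le> 0) \<and> (\<forall>i\<in>I. 0 \<le> b $ i) \<and> (\<Sum>i\<in>I. a $ i * b $ i) = 0"

end

theory Submission
  imports Defs
begin

text \<open>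
  Isolated calmness is equivalent to the triviality of the graphical derivative at the zero direction:
  if it fails, then normalized increments of solutions accumulate, by compactness of the unit sphere,
  at a nonzero direction along which the parameters are perturbed only by \<open>o(t)\<close>. For the solution map,
  dividing the two conditions of a perturbed solution by the step size and passing to the limit yields
  the linearized stationarity equation together with the componentwise tangency conditions to the
  graph of the normal cone. Conversely, along a direction satisfying these, the point
  \<open>(g xbar + t (Jg dx), ybar + t dy)\<close> stays exactly in that graph for small \<open>t\<close>, and the residuals
  of the curve \<open>(xbar + t dx, ybar + t dy)\<close>, which are \<open>o(t)\<close>, can be absorbed in the perturbations
  \<open>v\<close> and \<open>u\<close> with \<open>w = wbar\<close> fixed.
\<close>

section \<open>Graphical derivatives and isolated calmness\<close>

text \<open>Its graph is the Bouligand tangent cone to the graph of \<open>S\<close> at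
  \<open>(a, b)\<close>. Membership is asked only eventually, since a line in a tangent direction
  may lie in the graph for small steps only.\<close>

definition graphical_derivative ::
  "('a::real_normed_vector \<Rightarrow> 'b::real_normed_vector set) \<Rightarrow> 'a \<Rightarrow> 'b \<Rightarrow> 'a \<Rightarrow> 'b set" where
  "graphical_derivative S a b h =
     {d. \<exists>(t::nat \<Rightarrow> real) p s. (\<forall>k. 0 < t k) \<and> t \<longlonglongrightarrow> 0 \<and> (\<forall>\<^sub>F k in sequentially. s k \<in> S (p k)) \<and>
        (\<lambda>k. (p k - a) /\<^sub>R t k) \<longlonglongrightarrow> h \<and> (\<lambda>k. (s k - b) /\<^sub>R t k) \<longlonglongrightarrow> d}"

lemma tendsto_of_quotient:
  fixes z :: "nat \<Rightarrow> 'a::real_normed_vector" and t :: "nat \<Rightarrow> real"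
  assumes "\<And>k. 0 < t k" "t \<longlonglongrightarrow> 0" "(\<lambda>k. (z k - a) /\<^sub>R t k) \<longlonglongrightarrow> d"
  shows "z \<longlonglongrightarrow> a"
proof -
  have "(\<lambda>k. t k *\<^sub>R ((z k - a) /\<^sub>R t k)) \<longlonglongrightarrow> 0 *\<^sub>R d"
    by (intro tendsto_intros assms)
  moreover have "t k *\<^sub>R ((z k - a) /\<^sub>R t k) = z k - a" for k
    using assms(1)[of k] by simp
  ultimately show ?thesis by (simp add: LIM_zero_iff)
qed

text \<open>One way, the calmness estimate is divided by the step size and passed to the limit. The
  other way, a violating sequence is normalized; the values lie in a Euclidean space, whose unit
  sphere is compact.\<close>

lemma isolated_calmness_iff_graphical_derivative:
  fixes S :: "'a::real_normed_vector \<Rightarrow> 'b::euclidean_space set"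
  shows "isolated_calmness S a b \<longleftrightarrow> graphical_derivative S a b 0 \<subseteq> {0}"
proof
  assume "isolated_calmness S a b"
  then obtain \<kappa> V W where VW: "open V" "a \<in> V" "open W" "b \<in> W"
    and calm: "\<And>p. p \<in> V \<Longrightarrow> S p \<inter> W \<subseteq> cball b (\<kappa> * norm (p - a))"
    unfolding isolated_calmness_def by blast
  show "graphical_derivative S a b 0 \<subseteq> {0}"
  proof
    fix d assume "d \<in> graphical_derivative S a b 0"
    then obtain t p s where t: "\<And>k. 0 < t k" "t \<longlonglongrightarrow> 0"
      and S: "\<forall>\<^sub>F k in sequentially. s k \<in> S (p k)"
      and p: "(\<lambda>k. (p k - a) /\<^sub>R t k) \<longlonglongrightarrow> 0"
      and s: "(\<lambda>k. (s k - b) /\<^sub>R t k) \<longlonglongrightarrow> d"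
      unfolding graphical_derivative_def by blast
    have "\<forall>\<^sub>F k in sequentially. p k \<in> V" "\<forall>\<^sub>F k in sequentially. s k \<in> W"
      using topological_tendstoD[OF tendsto_of_quotient[OF t p]]
        topological_tendstoD[OF tendsto_of_quotient[OF t s]] VW by blast+
    then have "\<forall>\<^sub>F k in sequentially. norm ((s k - b) /\<^sub>R t k) \<le> \<kappa> * norm ((p k - a) /\<^sub>R t k)"
      using S
    proof eventually_elim
      case (elim k)
      then have "norm (s k - b) \<le> \<kappa> * norm (p k - a)"
        using calm by (force simp: dist_norm norm_minus_commute)
      then show ?case
        using t(1)[of k] by (simp add: divide_right_mono flip: divide_inverse_commute)
    qed
    then have "norm d \<le> \<kappa> * norm (0::'a)"
      by (intro tendsto_le[OF _ tendsto_mult_left[OF tendsto_norm[OF p]] tendsto_norm[OF s]]) simp_all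
    then show "d \<in> {0}" by simp
  qed
next
  assume trivial: "graphical_derivative S a b 0 \<subseteq> {0}"
  show "isolated_calmness S a b"
  proof (rule ccontr)
    assume not_calm: "\<not> isolated_calmness S a b"
    \<comment> \<open>The calmness attempt refuted here has constant k+1, the ball of radius 1/(k+1)
      around \<open>b\<close>, and the whole space as \<open>V\<close>: closeness of
      \<open>p\<close> to \<open>a\<close> comes for free from the strict inequality.\<close>
    have "\<exists>p s. s \<in> S p \<and> s \<in> ball b (1 / real (Suc k)) \<and> real (Suc k) * norm (p - a) < norm (s - b)" for k
    proof (rule ccontr)
      assume "\<not> ?thesis"
      then have "\<forall>p\<in>UNIV. S p \<inter> ball b (1 / real (Suc k)) \<subseteq> cball b (real (Suc k) * norm (p - a))"
        by (fastforce simp: dist_norm norm_minus_commute)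
      moreover have "open (ball b (1 / real (Suc k)))" "b \<in> ball b (1 / real (Suc k))" "0 < real (Suc k)"
        by (auto simp del: of_nat_Suc)
      ultimately show False
        using not_calm unfolding isolated_calmness_def by (meson UNIV_I open_UNIV)
    qed
    then obtain p s where S: "\<And>k. s k \<in> S (p k)"
      and sb: "\<And>k. s k \<in> ball b (1 / real (Suc k))"
      and far: "\<And>k. real (Suc k) * norm (p k - a) < norm (s k - b)"
      by metis
    \<comment> \<open>With this step size the quotients of \<open>s\<close> have norm 1, while those
      of \<open>p\<close> are at most 1/(k+1) and so tend to the direction 0.\<close>
    define t where "t k = norm (s k - b)" for k
    have t_pos: "0 < t k" for k
      unfolding t_def by (rule le_less_trans[OF _ far[of k]]) simp
    have t_le: "t k \<le> 1 / real (Suc k)" for k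
      using sb[of k] by (simp add: t_def dist_norm norm_minus_commute del: of_nat_Suc)
    have inv: "(\<lambda>k. 1 / real (Suc k)) \<longlonglongrightarrow> 0"
      using LIMSEQ_inverse_real_of_nat by (simp add: inverse_eq_divide)
    have t_lim: "t \<longlonglongrightarrow> 0"
      by (rule tendsto_sandwich[OF _ _ tendsto_const inv])
        (auto intro!: always_eventually t_le less_imp_le[OF t_pos] simp del: of_nat_Suc)
    have "\<forall>k. (s k - b) /\<^sub>R t k \<in> sphere 0 1"
      using t_pos by (auto simp: t_def)
    from seq_compactE[OF compact_imp_seq_compact[OF compact_sphere] this]
    obtain d r where d: "d \<in> sphere 0 1" and r: "strict_mono (r::nat \<Rightarrow> nat)"
      and lim: "((\<lambda>k. (s k - b) /\<^sub>R t k) \<circ> r) \<longlonglongrightarrow> d" .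
    have "norm ((p k - a) /\<^sub>R t k) \<le> 1 / real (Suc k)" for k
      unfolding norm_scaleR using far[of k] t_pos[of k]
      by (simp add: t_def field_simps del: of_nat_Suc)
    then have "(\<lambda>k. (p k - a) /\<^sub>R t k) \<longlonglongrightarrow> 0"
      by (intro Lim_null_comparison[OF _ inv] always_eventually) blast
    then have "(\<lambda>k. (p (r k) - a) /\<^sub>R t (r k)) \<longlonglongrightarrow> 0"
      using LIMSEQ_subseq_LIMSEQ[OF _ r] by (fastforce simp: o_def)
    moreover have "(\<lambda>k. t (r k)) \<longlonglongrightarrow> 0"
      using LIMSEQ_subseq_LIMSEQ[OF t_lim r] by (simp add: o_def)
    ultimately have "d \<in> graphical_derivative S a b 0"
      unfolding graphical_derivative_def using lim t_pos S
      by (auto simp: o_def intro!: exI[of _ "\<lambda>k. t (r k)"] exI[of _ "\<lambda>k. p (r k)"] exI[of _ "\<lambda>k. s (r k)"])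
    then show False using trivial d by auto
  qed
qed

section \<open>Derivatives along sequences\<close>

text \<open>A Frechet derivative is also a Hadamard derivative: the direction may vary with the
  step. The error is the relative remainder at \<open>z k\<close> times the norm of a convergent
  quotient, hence tends to 0.\<close>

lemma has_derivative_quotient_tendsto:
  fixes h :: "'a::real_normed_vector \<Rightarrow> 'b::real_normed_vector"
  assumes h: "(h has_derivative h') (at a)"
    and t: "\<And>k. 0 < t k" "t \<longlonglongrightarrow> 0"
    and z: "(\<lambda>k. (z k - a) /\<^sub>R t k) \<longlonglongrightarrow> d"
  shows "(\<lambda>k. (h (z k) - h a) /\<^sub>R t k) \<longlonglongrightarrow> h' d"
proof -
  interpret bounded_linear h' using h by (rule has_derivative_bounded_linear)
  \<comment> \<open>Division by zero makes \<open>R a\<close> equal to 0, so \<open>R\<close> is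
    continuous at \<open>a\<close> even if some \<open>z k\<close> hit \<open>a\<close>.\<close>
  define R where "R y = norm (h y - h a - h' (y - a)) / norm (y - a)" for y
  have "R \<midarrow>a\<rightarrow> R a"
    using h by (simp add: has_derivative_iff_norm R_def[abs_def])
  then have "(\<lambda>k. R (z k)) \<longlonglongrightarrow> R a"
    by (rule tendsto_compose_at[OF tendsto_of_quotient[OF t z], unfolded o_def]) simp
  then have "(\<lambda>k. R (z k) * norm ((z k - a) /\<^sub>R t k)) \<longlonglongrightarrow> R a * norm d"
    by (intro tendsto_mult tendsto_norm z)
  moreover have "norm ((h (z k) - h a) /\<^sub>R t k - h' ((z k - a) /\<^sub>R t k))
      = R (z k) * norm ((z k - a) /\<^sub>R t k)" for k
  proof -
    have "(h (z k) - h a) /\<^sub>R t k - h' ((z k - a) /\<^sub>R t k) = (h (z k) - h a - h' (z k - a)) /\<^sub>R t k"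
      by (simp only: scaleR scaleR_diff_right diff)
    then show ?thesis
      using t(1)[of k] by (cases "z k = a") (simp_all add: R_def zero)
  qed
  moreover have "R a = 0" by (simp add: R_def)
  ultimately have "(\<lambda>k. (h (z k) - h a) /\<^sub>R t k - h' ((z k - a) /\<^sub>R t k)) \<longlonglongrightarrow> 0"
    by (intro tendsto_norm_zero_cancel[of "\<lambda>k. _ k - _ k"]) (simp only: mult_zero_left)
  from tendsto_add[OF this tendsto[OF z]] show ?thesis by simp
qed

text \<open>Keeping the second point at \<open>a\<close> turns the strict estimate into the Frechet
  one.\<close>

lemma strictly_differentiable_imp_has_derivative:
  assumes "strictly_differentiable_at h a"
  shows "\<exists>A. (h has_derivative A) (at a)"
proof -
  from assms obtain A where A: "bounded_linear A"
    and strict: "\<And>e. e > 0 \<Longrightarrow> \<exists>\<delta>>0. \<forall>s\<in>ball a \<delta>. \<forall>t\<in>ball a \<delta>.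
        norm (h s - h t - A (s - t)) \<le> e * norm (s - t)"
    unfolding strictly_differentiable_at_def by blast
  have "(h has_derivative A) (at a)"
    unfolding has_derivative_at_alt
  proof (intro conjI allI impI A)
    fix e :: real assume "0 < e"
    from strict[OF this] obtain \<delta> where "\<delta> > 0"
      and "\<forall>s\<in>ball a \<delta>. \<forall>t\<in>ball a \<delta>. norm (h s - h t - A (s - t)) \<le> e * norm (s - t)"
      by blast
    then show "\<exists>\<delta>>0. \<forall>y. norm (y - a) < \<delta> \<longrightarrow> norm (h y - h a - A (y - a)) \<le> e * norm (y - a)"
      by (intro exI[of _ \<delta>]) (auto simp: dist_norm norm_minus_commute)
  qed
  then show ?thesis by blast
qed

section \<open>The graph of the normal cone and its tangent directions\<close>

text \<open>The polar cone is a product of lines (indices in \<open>E\<close>) and half-lines, so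
  its normal cone is computed coordinate by coordinate.\<close>

lemma mem_normal_cone_polar_constraint_cone:
  fixes E :: "'m::finite set"
  shows "z \<in> normal_cone (polar_cone (constraint_cone E)) y \<longleftrightarrow>
    (\<forall>i\<in>E. z $ i = 0) \<and> (\<forall>i\<in>-E. 0 \<le> y $ i \<and> z $ i \<le> 0 \<and> z $ i * y $ i = 0)"
    (is "?L \<longleftrightarrow> ?R")
proof
  assume L: ?L
  then have y: "\<forall>i\<in>-E. 0 \<le> y $ i"
    by (auto simp: normal_cone_def polar_constraint_cone split: if_splits)
  \<comment> \<open>Shifting one coordinate of \<open>y\<close> by \<open>c\<close> stays in the
    cone. The shifts 1 and -1 give \<open>z $ i = 0\<close> on \<open>E\<close>; off
    \<open>E\<close>, the shift 1 gives the sign of \<open>z $ i\<close>, and the shift to 0 gives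
    complementarity.\<close>
  have test: "c * z $ i \<le> 0" if "i \<in> E \<or> 0 \<le> y $ i + c" for i c
  proof -
    have "y + axis i c \<in> polar_cone (constraint_cone E)"
      using y that by (auto simp: polar_constraint_cone axis_def)
    then have "z \<bullet> (y + axis i c - y) \<le> 0"
      using L unfolding normal_cone_def by (metis (mono_tags, lifting) empty_iff mem_Collect_eq)
    then show ?thesis by (simp add: inner_axis mult.commute)
  qed
  have "z $ i = 0" if "i \<in> E" for i
    using test[of i 1] test[of i "-1"] that by simp
  moreover have "z $ i \<le> 0 \<and> z $ i * y $ i = 0" if "i \<in> -E" for i
  proof -
    have "z $ i \<le> 0" using test[of i 1] y that by force
    moreover have "0 \<le> z $ i * y $ i" using test[of i "- (y $ i)"] by (simp add: mult.commute)
    ultimately show ?thesis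
      using y that by (metis mult_nonpos_nonneg order_antisym)
  qed
  ultimately show ?R using y by blast
next
  assume R: ?R
  have "z $ i * (y' $ i - y $ i) \<le> 0" if "\<forall>i\<in>-E. 0 \<le> y' $ i" for y' i
    using R that by (cases "i \<in> E") (auto simp: right_diff_distrib mult_nonpos_nonneg dest!: bspec[where x = i])
  then show ?L
    using R by (auto simp: normal_cone_def polar_constraint_cone inner_vec_def intro!: sum_nonpos)
qed

text \<open>
  The tangent directions at \<open>(c, y)\<close> to the set of pairs \<open>(c, y)\<close> with \<open>c\<close> normal to the polar cone
  at \<open>y\<close>, for a base point in that set.
\<close>

definition critical_directions ::
  "'m::finite set \<Rightarrow> real^'m \<Rightarrow> real^'m \<Rightarrow> ((real^'m) \<times> (real^'m)) set" where
  "critical_directions E c y = {(a, b).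
     (\<forall>i\<in>E. a $ i = 0) \<and>
     (\<forall>i\<in>-E. (0 < y $ i \<longrightarrow> a $ i = 0) \<and> (c $ i < 0 \<longrightarrow> b $ i = 0) \<and>
        (c $ i = 0 \<and> y $ i = 0 \<longrightarrow> a $ i \<le> 0 \<and> 0 \<le> b $ i \<and> a $ i * b $ i = 0))}"

text \<open>Where \<open>y\<close> or \<open>c\<close> is strictly signed, the sign persists along
  the sequence and forces the complementary entry to be exactly 0. Where both vanish, the quotients
  themselves satisfy the sign and product conditions, which survive the limit.\<close>

lemma critical_directions_of_tangent:
  fixes E :: "'m::finite set"
  defines "N \<equiv> normal_cone (polar_cone (constraint_cone E))"
  assumes base: "c \<in> N y"
    and t: "\<And>k. 0 < t k" "t \<longlonglongrightarrow> 0"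
    and mem: "\<forall>\<^sub>F k in sequentially. C k \<in> N (Y k)"
    and C: "(\<lambda>k. (C k - c) /\<^sub>R t k) \<longlonglongrightarrow> a"
    and Y: "(\<lambda>k. (Y k - y) /\<^sub>R t k) \<longlonglongrightarrow> b"
  shows "(a, b) \<in> critical_directions E c y"
proof -
  have Ci: "(\<lambda>k. (C k $ i - c $ i) / t k) \<longlonglongrightarrow> a $ i" for i
    using tendsto_vec_nth[OF C, of i] by (simp add: divide_inverse mult.commute)
  have Yi: "(\<lambda>k. (Y k $ i - y $ i) / t k) \<longlonglongrightarrow> b $ i" for i
    using tendsto_vec_nth[OF Y, of i] by (simp add: divide_inverse mult.commute)
  have C_lim: "(\<lambda>k. C k $ i) \<longlonglongrightarrow> c $ i" and Y_lim: "(\<lambda>k. Y k $ i) \<longlonglongrightarrow> y $ i" for i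
    using tendsto_of_quotient[OF t C] tendsto_of_quotient[OF t Y] by (auto intro: tendsto_vec_nth)
  have eqE: "\<forall>\<^sub>F k in sequentially. C k $ i = 0" if "i \<in> E" for i
    using mem by (rule eventually_mono) (use that in \<open>auto simp: N_def mem_normal_cone_polar_constraint_cone\<close>)
  have ineq: "\<forall>\<^sub>F k in sequentially. 0 \<le> Y k $ i \<and> C k $ i \<le> 0 \<and> C k $ i * Y k $ i = 0"
    if "i \<in> -E" for i
    using mem by (rule eventually_mono) (use that in \<open>auto simp: N_def mem_normal_cone_polar_constraint_cone\<close>)
  have base': "\<forall>i\<in>E. c $ i = 0" "\<forall>i\<in>-E. 0 \<le> y $ i \<and> c $ i \<le> 0 \<and> c $ i * y $ i = 0"
    using base by (auto simp: N_def mem_normal_cone_polar_constraint_cone)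
  have zeroC: "a $ i = 0" if "c $ i = 0" "\<forall>\<^sub>F k in sequentially. C k $ i = 0" for i
  proof (rule LIMSEQ_unique[OF Ci])
    show "(\<lambda>k. (C k $ i - c $ i) / t k) \<longlonglongrightarrow> 0"
      by (rule tendsto_eventually) (use that in \<open>auto elim: eventually_mono\<close>)
  qed
  have "a $ i = 0" if "i \<in> E" for i
    using zeroC eqE base' that by blast
  moreover have "a $ i = 0" if i: "i \<in> -E" "0 < y $ i" for i
  proof (rule zeroC)
    show "c $ i = 0" using base' i by auto
    show "\<forall>\<^sub>F k in sequentially. C k $ i = 0"
      using ineq[OF i(1)] order_tendstoD(1)[OF Y_lim i(2)] by eventually_elim auto
  qed
  moreover have "b $ i = 0" if i: "i \<in> -E" "c $ i < 0" for i
  proof (rule LIMSEQ_unique[OF Yi])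
    have "\<forall>\<^sub>F k in sequentially. (Y k $ i - y $ i) / t k = 0"
      using ineq[OF i(1)] order_tendstoD(2)[OF C_lim i(2)]
      by eventually_elim (use base' i in force)
    then show "(\<lambda>k. (Y k $ i - y $ i) / t k) \<longlonglongrightarrow> 0" by (rule tendsto_eventually)
  qed
  moreover have "a $ i \<le> 0 \<and> 0 \<le> b $ i \<and> a $ i * b $ i = 0"
    if i: "i \<in> -E" "c $ i = 0" "y $ i = 0" for i
  proof (intro conjI)
    have "\<forall>\<^sub>F k in sequentially. (C k $ i - c $ i) / t k \<le> 0"
      using ineq[OF i(1)] by eventually_elim (use t(1) i in \<open>auto simp: divide_le_0_iff less_imp_le\<close>)
    then show "a $ i \<le> 0" by (intro tendsto_upperbound[OF Ci]) auto
    have "\<forall>\<^sub>F k in sequentially. 0 \<le> (Y k $ i - y $ i) / t k"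
      using ineq[OF i(1)] by eventually_elim (use t(1) i in \<open>auto simp: zero_le_divide_iff less_imp_le\<close>)
    then show "0 \<le> b $ i" by (intro tendsto_lowerbound[OF Yi]) auto
    have "\<forall>\<^sub>F k in sequentially. (C k $ i - c $ i) / t k * ((Y k $ i - y $ i) / t k) = 0"
      using ineq[OF i(1)] by eventually_elim (use i in auto)
    then show "a $ i * b $ i = 0"
      by (rule LIMSEQ_unique[OF tendsto_mult[OF Ci Yi] tendsto_eventually])
  qed
  ultimately show ?thesis by (auto simp: critical_directions_def)
qed

text \<open>The graph is a finite union of polyhedral sets, so a tangent direction can be followed
  along a straight line without leaving it at first.\<close>

lemma tangent_of_critical_directions:
  fixes E :: "'m::finite set"
  defines "N \<equiv> normal_cone (polar_cone (constraint_cone E))"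
  assumes base: "c \<in> N y" and ab: "(a, b) \<in> critical_directions E c y"
    and t: "\<And>k. 0 < t k" "t \<longlonglongrightarrow> 0"
  shows "\<forall>\<^sub>F k in sequentially. c + t k *\<^sub>R a \<in> N (y + t k *\<^sub>R b)"
proof -
  have base': "\<forall>i\<in>E. c $ i = 0" "\<forall>i\<in>-E. 0 \<le> y $ i \<and> c $ i \<le> 0 \<and> c $ i * y $ i = 0"
    using base by (auto simp: N_def mem_normal_cone_polar_constraint_cone)
  have "(\<lambda>k. c $ i + t k * a $ i) \<longlonglongrightarrow> c $ i + 0 * a $ i"
    "(\<lambda>k. y $ i + t k * b $ i) \<longlonglongrightarrow> y $ i + 0 * b $ i" for i
    by (intro tendsto_intros t)+
  then have neg: "c $ i < 0 \<Longrightarrow> \<forall>\<^sub>F k in sequentially. c $ i + t k * a $ i < 0"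
    and pos: "0 < y $ i \<Longrightarrow> \<forall>\<^sub>F k in sequentially. 0 < y $ i + t k * b $ i" for i
    by (auto dest: order_tendstoD)
  have "\<forall>\<^sub>F k in sequentially. (i \<in> E \<longrightarrow> c $ i + t k * a $ i = 0) \<and>
     (i \<in> -E \<longrightarrow> 0 \<le> y $ i + t k * b $ i \<and> c $ i + t k * a $ i \<le> 0 \<and>
        (c $ i + t k * a $ i) * (y $ i + t k * b $ i) = 0)" for i
  proof -
    \<comment> \<open>These are the cases left by complementarity at the base point. In the second
      and third the strict sign survives small steps; in the last the line starts at 0 and inherits
      the conditions on \<open>a\<close> and \<open>b\<close>.\<close>
    consider "i \<in> E" | "i \<in> -E" "c $ i < 0" | "i \<in> -E" "0 < y $ i" | "i \<in> -E" "c $ i = 0" "y $ i = 0"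
      using base' by force
    then show ?thesis
    proof cases
      case 1
      then show ?thesis using base' ab by (auto simp: critical_directions_def)
    next
      case 2
      then have "y $ i = 0" "b $ i = 0" using base' ab by (force simp: critical_directions_def)+
      then show ?thesis
        by (intro eventually_mono[OF neg[OF 2(2)]]) (use 2(1) in simp)
    next
      case 3
      then have "c $ i = 0" "a $ i = 0" using base' ab by (force simp: critical_directions_def)+
      then show ?thesis
        by (intro eventually_mono[OF pos[OF 3(2)]]) (use 3(1) in simp)
    next
      case 4
      then have "a $ i \<le> 0 \<and> 0 \<le> b $ i \<and> a $ i * b $ i = 0" using ab by (auto simp: critical_directions_def)
      then show ?thesis
        using 4 t(1) by (intro always_eventually) (auto simp: mult_le_0_iff less_imp_le)
    qed
  qed
  then have "\<forall>\<^sub>F k in sequentially. \<forall>i. (i \<in> E \<longrightarrow> c $ i + t k * a $ i = 0) \<and>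
     (i \<in> -E \<longrightarrow> 0 \<le> y $ i + t k * b $ i \<and> c $ i + t k * a $ i \<le> 0 \<and>
        (c $ i + t k * a $ i) * (y $ i + t k * b $ i) = 0)"
    by (rule eventually_all_finite)
  then show ?thesis
    by eventually_elim (auto simp: N_def mem_normal_cone_polar_constraint_cone)
qed

section \<open>The graphical derivative of a perturbed complementarity system\<close>

text \<open>The game enters only through an equation with right-hand side \<open>v\<close> and an
  inclusion shifted by \<open>u\<close>. As the parameter direction is 0, the derivatives are
  evaluated with a zero increment in \<open>w\<close>.\<close>

lemma graphical_derivative_complementarity_system:
  fixes E :: "'m::finite set"
    and S :: "'w::real_normed_vector \<times> 'v::real_normed_vector \<times> (real^'m) \<Rightarrow>
      ('x::real_normed_vector \<times> (real^'m)) set"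
  defines "N \<equiv> normal_cone (polar_cone (constraint_cone E))"
  assumes S: "\<And>x y w v u. (x, y) \<in> S (w, v, u) \<longleftrightarrow> \<Phi> (x, y, w) = v \<and> F (x, w) - u \<in> N y"
    and base: "(x0, y0) \<in> S (w0, 0, 0)"
    and \<Phi>: "(\<Phi> has_derivative \<Phi>') (at (x0, y0, w0))"
    and F: "(F has_derivative F') (at (x0, w0))"
  shows "(dx, dy) \<in> graphical_derivative S (w0, 0, 0) (x0, y0) 0 \<longleftrightarrow>
    \<Phi>' (dx, dy, 0) = 0 \<and> (F' (dx, 0), dy) \<in> critical_directions E (F (x0, w0)) y0"
proof
  have base': "\<Phi> (x0, y0, w0) = 0" "F (x0, w0) \<in> N y0"
    using base S by auto
  {
    assume "(dx, dy) \<in> graphical_derivative S (w0, 0, 0) (x0, y0) 0"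
    then obtain t p s where t: "\<And>k. 0 < t k" "t \<longlonglongrightarrow> 0"
      and mem: "\<forall>\<^sub>F k in sequentially. s k \<in> S (p k)"
      and p: "(\<lambda>k. (p k - (w0, 0, 0)) /\<^sub>R t k) \<longlonglongrightarrow> 0"
      and s: "(\<lambda>k. (s k - (x0, y0)) /\<^sub>R t k) \<longlonglongrightarrow> (dx, dy)"
      unfolding graphical_derivative_def by blast
    define x where "x k = fst (s k)" for k
    define y where "y k = snd (s k)" for k
    define w where "w k = fst (p k)" for k
    define v where "v k = fst (snd (p k))" for k
    define u where "u k = snd (snd (p k))" for k
    have x: "(\<lambda>k. (x k - x0) /\<^sub>R t k) \<longlonglongrightarrow> dx" and y: "(\<lambda>k. (y k - y0) /\<^sub>R t k) \<longlonglongrightarrow> dy"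
      using tendsto_fst[OF s] tendsto_snd[OF s] by (simp_all add: x_def y_def)
    have w: "(\<lambda>k. (w k - w0) /\<^sub>R t k) \<longlonglongrightarrow> 0"
      using tendsto_fst[OF p] by (simp add: w_def)
    have v: "(\<lambda>k. v k /\<^sub>R t k) \<longlonglongrightarrow> 0"
      using tendsto_fst[OF tendsto_snd[OF p]] by (simp add: v_def)
    have u: "(\<lambda>k. u k /\<^sub>R t k) \<longlonglongrightarrow> 0"
      using tendsto_snd[OF tendsto_snd[OF p]] by (simp add: u_def)
    have mem': "\<forall>\<^sub>F k in sequentially. \<Phi> (x k, y k, w k) = v k \<and> F (x k, w k) - u k \<in> N (y k)"
      using mem by (rule eventually_mono) (simp add: x_def y_def w_def v_def u_def flip: S)
    have "(\<lambda>k. ((x k, y k, w k) - (x0, y0, w0)) /\<^sub>R t k) \<longlonglongrightarrow> (dx, dy, 0)"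
      using tendsto_Pair[OF x tendsto_Pair[OF y w]] by simp
    from has_derivative_quotient_tendsto[OF \<Phi> t this]
    have "(\<lambda>k. \<Phi> (x k, y k, w k) /\<^sub>R t k) \<longlonglongrightarrow> \<Phi>' (dx, dy, 0)" by (simp add: base')
    \<comment> \<open>Eventually this is the quotient of \<open>v k\<close>, which vanishes in the
      limit.\<close>
    moreover have "(\<lambda>k. \<Phi> (x k, y k, w k) /\<^sub>R t k) \<longlonglongrightarrow> 0"
      by (rule Lim_transform_eventually[OF v]) (use mem' in eventually_elim, simp)
    ultimately have "\<Phi>' (dx, dy, 0) = 0"
      by (rule LIMSEQ_unique)
    moreover have "(F' (dx, 0), dy) \<in> critical_directions E (F (x0, w0)) y0"
    proof (rule critical_directions_of_tangent[OF base'(2)[unfolded N_def] t _ _ y])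
      show "\<forall>\<^sub>F k in sequentially. F (x k, w k) - u k \<in> normal_cone (polar_cone (constraint_cone E)) (y k)"
        using mem' by eventually_elim (simp add: N_def)
      have "(\<lambda>k. ((x k, w k) - (x0, w0)) /\<^sub>R t k) \<longlonglongrightarrow> (dx, 0)"
        using tendsto_Pair[OF x w] by simp
      from tendsto_diff[OF has_derivative_quotient_tendsto[OF F t this] u]
      show "(\<lambda>k. (F (x k, w k) - u k - F (x0, w0)) /\<^sub>R t k) \<longlonglongrightarrow> F' (dx, 0)"
        by (simp add: algebra_simps)
    qed
    ultimately show "\<Phi>' (dx, dy, 0) = 0 \<and> (F' (dx, 0), dy) \<in> critical_directions E (F (x0, w0)) y0" ..
  next
    assume crit: "\<Phi>' (dx, dy, 0) = 0 \<and> (F' (dx, 0), dy) \<in> critical_directions E (F (x0, w0)) y0"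
    define t where "t k = inverse (real (Suc k))" for k
    have t: "0 < t k" "t \<longlonglongrightarrow> 0" for k
      using LIMSEQ_inverse_real_of_nat by (simp_all add: t_def[abs_def])
    define x where "x k = x0 + t k *\<^sub>R dx" for k
    define y where "y k = y0 + t k *\<^sub>R dy" for k
    \<comment> \<open>The second entry makes the equation hold exactly. The third leaves
      \<open>F - u\<close> equal to the linearization of \<open>F\<close>, so that the inclusion is
      the one along the straight line.\<close>
    define p where "p k = (w0, \<Phi> (x k, y k, w0), F (x k, w0) - (F (x0, w0) + t k *\<^sub>R F' (dx, 0)))" for k
    have x: "(x k - x0) /\<^sub>R t k = dx" and y: "(y k - y0) /\<^sub>R t k = dy" for k
      using t(1)[of k] by (simp_all add: x_def y_def)
    have "\<forall>\<^sub>F k in sequentially. (x k, y k) \<in> S (p k)"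
      using tangent_of_critical_directions[OF base'(2)[unfolded N_def] conjunct2[OF crit] t]
      by eventually_elim (simp add: p_def S N_def y_def)
    moreover have "(\<lambda>k. (p k - (w0, 0, 0)) /\<^sub>R t k) \<longlonglongrightarrow> 0"
    proof -
      have "(\<lambda>k. \<Phi> (x k, y k, w0) /\<^sub>R t k) \<longlonglongrightarrow> 0"
        using has_derivative_quotient_tendsto[OF \<Phi> t, of "\<lambda>k. (x k, y k, w0)" "(dx, dy, 0)"] crit
        by (simp add: x y base')
      moreover have "(\<lambda>k. (F (x k, w0) - (F (x0, w0) + t k *\<^sub>R F' (dx, 0))) /\<^sub>R t k) \<longlonglongrightarrow> 0"
      proof -
        have "(\<lambda>k. (F (x k, w0) - F (x0, w0)) /\<^sub>R t k - F' (dx, 0)) \<longlonglongrightarrow> 0"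
          using has_derivative_quotient_tendsto[OF F t, of "\<lambda>k. (x k, w0)" "(dx, 0)"]
          by (simp add: x LIM_zero)
        moreover have "(F (x k, w0) - F (x0, w0)) /\<^sub>R t k - F' (dx, 0)
            = (F (x k, w0) - (F (x0, w0) + t k *\<^sub>R F' (dx, 0))) /\<^sub>R t k" for k
          using t(1)[of k] by (simp add: algebra_simps)
        ultimately show ?thesis by simp
      qed
      ultimately show ?thesis
        by (auto simp: p_def zero_prod_def intro!: tendsto_Pair)
    qed
    moreover have "(\<lambda>k. ((x k, y k) - (x0, y0)) /\<^sub>R t k) \<longlonglongrightarrow> (dx, dy)"
      by (simp add: x y)
    ultimately show "(dx, dy) \<in> graphical_derivative S (w0, 0, 0) (x0, y0) 0"
      unfolding graphical_derivative_def mem_Collect_eq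
      by (intro exI[of _ t] exI[of _ p] exI[of _ "\<lambda>k. (x k, y k)"] conjI allI t)
  }
qed

section \<open>The stationarity map of the game and its derivative\<close>

text \<open>Stacking the block equations of all players gives the single map that serves as
  \<open>\<Phi>\<close>.\<close>

definition stationarity ::
  "('n::finite \<Rightarrow> 'N) \<Rightarrow> ('N \<Rightarrow> (real^'n) \<times> 'w \<Rightarrow> real) \<Rightarrow>
   ((real^'n) \<times> 'w \<Rightarrow> real^'m::finite) \<Rightarrow> (real^'n) \<times> (real^'m) \<times> 'w \<Rightarrow> real^'n" where
  "stationarity owner f F = (\<lambda>(x, y, w). \<chi> i.
     gradient_x (f (owner i)) (x, w) $ i + (transpose (jacobian_x F (x, w)) *v y) $ i)"

text \<open>Each coordinate has exactly one owner, so the conditions over players and their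
  coordinates amount to one vector equation.\<close>

lemma mem_S_Lag_iff:
  "(x, y) \<in> S_Lag owner E f F (w, v, u) \<longleftrightarrow>
    stationarity owner f F (x, y, w) = v \<and>
    F (x, w) - u \<in> normal_cone (polar_cone (constraint_cone E)) y"
proof -
  have "(0 = - F (x, w) + u + z) = (z = F (x, w) - u)" for z
    by (auto simp: algebra_simps)
  then show ?thesis
    by (auto simp: S_Lag_def stationarity_def vec_eq_iff[of "\<chi> i. _ i"])
qed

lemma has_derivative_vecI:
  fixes h :: "'a::real_normed_vector \<Rightarrow> real^'n::finite"
  assumes "\<And>i. ((\<lambda>z. h z $ i) has_derivative (\<lambda>d. h' d $ i)) (at a within s)"
  shows "(h has_derivative h') (at a within s)"
  unfolding has_derivative_componentwise_within[of h]
  using assms by (auto simp: Basis_vec_def inner_axis)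

text \<open>The multiplier term is bilinear in the Jacobian and \<open>y\<close>, so the product
  rule yields one summand with \<open>dy\<close> and one with \<open>B\<close>.\<close>

lemma has_derivative_stationarity:
  assumes A: "\<And>\<nu>. (gradient_x (f \<nu>) has_derivative A \<nu>) (at (x0, w0))"
    and B: "(jacobian_x F has_derivative B) (at (x0, w0))"
  shows "(stationarity owner f F has_derivative (\<lambda>(dx, dy, dw). \<chi> i.
      A (owner i) (dx, dw) $ i +
      (transpose (jacobian_x F (x0, w0)) *v dy + transpose (B (dx, dw)) *v y0) $ i))
    (at (x0, y0, w0))"
proof (rule has_derivative_vecI)
  fix i
  \<comment> \<open>Gradients and Jacobian see only \<open>(x, w)\<close>; composing with this
    projection makes them functions of the full triple.\<close>
  have proj: "((\<lambda>z. (fst z, snd (snd z))) has_derivative (\<lambda>d. (fst d, snd (snd d)))) (at (x0, y0, w0))"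
    by (auto intro!: derivative_eq_intros)
  have A': "((\<lambda>z. gradient_x (f \<nu>) (fst z, snd (snd z))) has_derivative (\<lambda>d. A \<nu> (fst d, snd (snd d))))
      (at (x0, y0, w0))" for \<nu>
    by (rule has_derivative_compose[OF proj]) (simp add: A)
  have B': "((\<lambda>z. jacobian_x F (fst z, snd (snd z))) has_derivative (\<lambda>d. B (fst d, snd (snd d))))
      (at (x0, y0, w0))"
    by (rule has_derivative_compose[OF proj]) (simp add: B)
  note nth = bounded_linear.has_derivative[OF bounded_linear_vec_nth]
  have "((\<lambda>z. gradient_x (f (owner i)) (fst z, snd (snd z)) $ i +
        (\<Sum>j\<in>UNIV. jacobian_x F (fst z, snd (snd z)) $ j $ i * fst (snd z) $ j)) has_derivative
      (\<lambda>d. A (owner i) (fst d, snd (snd d)) $ i +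
        (\<Sum>j\<in>UNIV. jacobian_x F (x0, w0) $ j $ i * fst (snd d) $ j +
           B (fst d, snd (snd d)) $ j $ i * y0 $ j))) (at (x0, y0, w0))"
    by (rule derivative_eq_intros nth A' B' refl | simp)+
  then show "((\<lambda>z. stationarity owner f F z $ i) has_derivative (\<lambda>d. (case d of (dx, dy, dw) \<Rightarrow> \<chi> i.
      A (owner i) (dx, dw) $ i +
      (transpose (jacobian_x F (x0, w0)) *v dy + transpose (B (dx, dw)) *v y0) $ i) $ i))
    (at (x0, y0, w0))"
    by (simp add: stationarity_def split_beta matrix_vector_mult_def transpose_def sum.distrib)
qed

lemma has_derivative_fst_section:
  assumes "(h has_derivative h') (at (x, w))"
  shows "((\<lambda>x'. h (x', w)) has_derivative (\<lambda>d. h' (d, 0))) (at x)"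
proof -
  have "((\<lambda>x'. (x', w)) has_derivative (\<lambda>d. (d, 0))) (at x)"
    by (auto intro!: derivative_eq_intros)
  from has_derivative_compose[OF this assms] show ?thesis .
qed

lemma gradient_eqI:
  assumes "(h has_derivative (\<lambda>d. c \<bullet> d)) (at x)"
  shows "gradient h x = c"
  by (simp add: gradient_def vec_eq_iff inner_axis frechet_derivative_at[OF assms, symmetric])

lemma has_derivative_gradient:
  fixes h :: "real^'n::finite \<Rightarrow> real"
  assumes "h differentiable (at x)"
  shows "(h has_derivative (\<lambda>d. gradient h x \<bullet> d)) (at x)"
proof -
  have h: "(h has_derivative frechet_derivative h (at x)) (at x)"
    using assms by (simp add: frechet_derivative_works)
  then interpret bounded_linear "frechet_derivative h (at x)"
    by (rule has_derivative_bounded_linear)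
  have "frechet_derivative h (at x) = (\<lambda>d. gradient h x \<bullet> d)"
  proof
    fix d
    have "frechet_derivative h (at x) d = frechet_derivative h (at x) (\<Sum>i\<in>UNIV. d $ i *\<^sub>R axis i 1)"
      using basis_expansion[of d] by (simp add: scalar_mult_eq_scaleR)
    also have "\<dots> = gradient h x \<bullet> d"
      by (simp add: sum scaleR inner_vec_def gradient_def mult.commute)
    finally show "frechet_derivative h (at x) d = gradient h x \<bullet> d" .
  qed
  then show ?thesis using h by simp
qed

text \<open>Row i of \<open>G_matrix\<close> is a Hessian row of the Lagrangian of
  \<open>owner i\<close>. Differentiating the gradient of that Lagrangian along \<open>x\<close>
  identifies the product with the \<open>dx\<close> part of the derivative of
  \<open>stationarity\<close>.\<close>

lemma G_matrix_mult_vec: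
  fixes f :: "'N \<Rightarrow> (real^'n::finite) \<times> 'w::real_normed_vector \<Rightarrow> real"
    and F :: "(real^'n) \<times> 'w \<Rightarrow> real^'m::finite"
  assumes U: "open U" "(x0, w0) \<in> U"
    and f: "\<And>\<nu> x w. (x, w) \<in> U \<Longrightarrow> (\<lambda>x'. f \<nu> (x', w)) differentiable (at x)"
    and F: "\<And>x w. (x, w) \<in> U \<Longrightarrow> (\<lambda>x'. F (x', w)) differentiable (at x)"
    and A: "\<And>\<nu>. (gradient_x (f \<nu>) has_derivative A \<nu>) (at (x0, w0))"
    and B: "(jacobian_x F has_derivative B) (at (x0, w0))"
  shows "(G_matrix owner (\<lambda>\<nu> x. f \<nu> (x, w0)) (\<lambda>x. F (x, w0)) x0 y0 *v dx) $ i =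
    A (owner i) (dx, 0) $ i + (transpose (B (dx, 0)) *v y0) $ i"
proof -
  define h where "h = (\<lambda>x. lagrangian (\<lambda>\<nu> x. f \<nu> (x, w0)) (\<lambda>x. F (x, w0)) (owner i) x y0)"
  \<comment> \<open>On this open slice the formula for the gradient holds throughout, so it may be
    differentiated at \<open>x0\<close>.\<close>
  define V where "V = (\<lambda>x. (x, w0)) -` U"
  have V: "open V" "x0 \<in> V"
    using U by (auto simp: V_def intro!: open_vimage continuous_intros)
  have grad: "gradient h x = gradient_x (f (owner i)) (x, w0) + transpose (jacobian_x F (x, w0)) *v y0"
    if "x \<in> V" for x
  proof (rule gradient_eqI)
    have xU: "(x, w0) \<in> U" using that by (simp add: V_def)
    have fd: "((\<lambda>x'. f (owner i) (x', w0)) has_derivative (\<lambda>d. gradient_x (f (owner i)) (x, w0) \<bullet> d)) (at x)"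
      using has_derivative_gradient[OF f[OF xU]] by (simp add: gradient_x_def)
    have Fd: "((\<lambda>x'. F (x', w0)) has_derivative (\<lambda>d. jacobian_x F (x, w0) *v d)) (at x)"
      using F[OF xU] by (simp add: jacobian_works jacobian_x_def)
    have "(h has_derivative (\<lambda>d. gradient_x (f (owner i)) (x, w0) \<bullet> d + y0 \<bullet> (jacobian_x F (x, w0) *v d))) (at x)"
      unfolding h_def lagrangian_def
      by (intro has_derivative_add fd has_derivative_inner_right Fd)
    then show "(h has_derivative (\<lambda>d. (gradient_x (f (owner i)) (x, w0) +
        transpose (jacobian_x F (x, w0)) *v y0) \<bullet> d)) (at x)"
      by (simp add: inner_add_left dot_lmul_matrix)
  qed
  have "((\<lambda>x. gradient_x (f (owner i)) (x, w0) + transpose (jacobian_x F (x, w0)) *v y0) has_derivative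
      (\<lambda>d. A (owner i) (d, 0) + transpose (B (d, 0)) *v y0)) (at x0)"
  proof (rule has_derivative_add)
    show "((\<lambda>x. gradient_x (f (owner i)) (x, w0)) has_derivative (\<lambda>d. A (owner i) (d, 0))) (at x0)"
      by (rule has_derivative_fst_section[OF A])
    have "linear (\<lambda>M::real^'n^'m. transpose M *v y0)"
      by (rule linearI)
        (simp_all add: vec_eq_iff vector_matrix_mult_def distrib_right distrib_left sum.distrib sum_distrib_left mult_ac)
    then show "((\<lambda>x. transpose (jacobian_x F (x, w0)) *v y0) has_derivative (\<lambda>d. transpose (B (d, 0)) *v y0)) (at x0)"
      unfolding linear_conv_bounded_linear
      by (rule bounded_linear.has_derivative) (rule has_derivative_fst_section[OF B])
  qed
  then have D: "(gradient h has_derivative (\<lambda>d. A (owner i) (d, 0) + transpose (B (d, 0)) *v y0)) (at x0)"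
    by (rule has_derivative_transform_within_open[OF _ V]) (simp add: grad)
  have "hessian h x0 *v dx = A (owner i) (dx, 0) + transpose (B (dx, 0)) *v y0"
    unfolding hessian_def jacobian_def frechet_derivative_at[OF D, symmetric]
    using has_derivative_linear[OF D] by (simp only: matrix_works linear_matrix_vector_mul_eq)
  moreover have "(G_matrix owner (\<lambda>\<nu> x. f \<nu> (x, w0)) (\<lambda>x. F (x, w0)) x0 y0 *v dx) $ i = (hessian h x0 *v dx) $ i"
    by (simp add: G_matrix_def matrix_vector_mult_def h_def)
  ultimately show ?thesis by simp
qed

section \<open>Subvectors and index sets\<close>

lemma transpose_rows_mult_union:
  assumes "I \<inter> J = {}" "\<And>i. i \<notin> I \<union> J \<Longrightarrow> b $ i = 0"
  shows "transpose_rows_mult A I b + transpose_rows_mult A J b = transpose A *v b"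
proof -
  have "transpose_rows_mult A I b + transpose_rows_mult A J b = (\<Sum>i\<in>I \<union> J. b $ i *\<^sub>R row i A)"
    using assms(1) by (simp add: transpose_rows_mult_def sum.union_disjoint)
  also have "\<dots> = (\<Sum>i\<in>UNIV. b $ i *\<^sub>R row i A)"
    using assms(2) by (intro sum.mono_neutral_left) auto
  also have "\<dots> = transpose A *v b"
    by (simp add: vec_eq_iff matrix_vector_mult_def transpose_def row_def mult.commute)
  finally show ?thesis .
qed

text \<open>A vanishing sum of nonpositive products has only vanishing terms.\<close>

lemma complementary_on_iff:
  "complementary_on I a b \<longleftrightarrow> (\<forall>i\<in>I. a $ i \<le> 0 \<and> 0 \<le> b $ i \<and> a $ i * b $ i = 0)"
proof -
  have "(\<Sum>i\<in>I. a $ i * b $ i) = 0 \<longleftrightarrow> (\<forall>i\<in>I. a $ i * b $ i = 0)"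
    if "\<forall>i\<in>I. a $ i \<le> 0" "\<forall>i\<in>I. 0 \<le> b $ i"
    using sum_nonneg_eq_0_iff[of I "\<lambda>i. - (a $ i * b $ i)"] that
    by (simp add: sum_negf mult_nonpos_nonneg)
  then show ?thesis by (auto simp: complementary_on_def)
qed

text \<open>By complementarity, the indices outside both index sets are the inactive inequalities,
  where \<open>g x $ i < 0\<close> and \<open>y $ i = 0\<close>; there the multiplier direction must
  vanish.\<close>

lemma mem_critical_directions_iff:
  fixes g :: "'x \<Rightarrow> real^'m::finite"
  assumes "g x \<in> normal_cone (polar_cone (constraint_cone E)) y"
  shows "(a, b) \<in> critical_directions E (g x) y \<longleftrightarrow>
    (\<forall>i\<in>alpha_set E g x y. a $ i = 0) \<and> complementary_on (beta_set E g x y) a b \<and>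
    (\<forall>i. i \<notin> alpha_set E g x y \<union> beta_set E g x y \<longrightarrow> b $ i = 0)"
proof -
  have cases: "i \<in> E \<or> g x $ i < 0 \<and> y $ i = 0 \<or> g x $ i = 0 \<and> 0 < y $ i \<or> g x $ i = 0 \<and> y $ i = 0" for i
    using assms unfolding mem_normal_cone_polar_constraint_cone by force
  have "(i \<in> E \<longrightarrow> a $ i = 0) \<and> (i \<in> -E \<longrightarrow> (0 < y $ i \<longrightarrow> a $ i = 0) \<and> (g x $ i < 0 \<longrightarrow> b $ i = 0) \<and>
        (g x $ i = 0 \<and> y $ i = 0 \<longrightarrow> a $ i \<le> 0 \<and> 0 \<le> b $ i \<and> a $ i * b $ i = 0)) \<longleftrightarrow>
      (i \<in> alpha_set E g x y \<longrightarrow> a $ i = 0) \<and>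
      (i \<in> beta_set E g x y \<longrightarrow> a $ i \<le> 0 \<and> 0 \<le> b $ i \<and> a $ i * b $ i = 0) \<and>
      (i \<notin> alpha_set E g x y \<union> beta_set E g x y \<longrightarrow> b $ i = 0)" (is "?L i \<longleftrightarrow> ?R i") for i
    using cases[of i] by (auto simp: alpha_set_def beta_set_def)
  then have "(\<forall>i. ?L i) \<longleftrightarrow> (\<forall>i. ?R i)" by (simp only:)
  then show ?thesis
    unfolding critical_directions_def complementary_on_iff mem_Collect_eq prod.case Ball_def
    by (simp only: all_conj_distrib)
qed

section \<open>The criterion for the game\<close>

theorem theorem3p4:
  fixes owner :: "'n::finite \<Rightarrow> 'N::finite"
    and E :: "'m::finite set"
    and f :: "'N \<Rightarrow> (real^'n) \<times> (real^'d::finite) \<Rightarrow> real"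
    and F :: "(real^'n) \<times> (real^'d) \<Rightarrow> real^'m"
    and xbar :: "real^'n" and ybar :: "real^'m" and wbar :: "real^'d"
    and U :: "((real^'n) \<times> (real^'d)) set"
    and \<theta> :: "'N \<Rightarrow> real^'n \<Rightarrow> real"
    and g :: "real^'n \<Rightarrow> real^'m"
    and \<alpha> \<beta> :: "'m set"
    and G :: "real^'n^'n"
    and Jg :: "real^'n^'m"
  defines "\<theta> \<equiv> \<lambda>\<nu> x. f \<nu> (x, wbar)"
    and "g \<equiv> \<lambda>x. F (x, wbar)"
    and "\<alpha> \<equiv> alpha_set E g xbar ybar"
    and "\<beta> \<equiv> beta_set E g xbar ybar"
    and "G \<equiv> G_matrix owner \<theta> g xbar ybar"
    and "Jg \<equiv> jacobian g (at xbar)"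
  assumes solution: "(xbar, ybar) \<in> S_Lag owner E f F (wbar, 0, 0)"
    and nbhd: "open U" "(xbar, wbar) \<in> U"
    and f_twice_diff: "\<And>\<nu> x w. (x, w) \<in> U \<Longrightarrow>
          (\<lambda>x'. f \<nu> (x', w)) differentiable (at x) \<and>
          (\<lambda>x'. gradient_x (f \<nu>) (x', w)) differentiable (at x)"
    and F_twice_diff: "\<And>x w. (x, w) \<in> U \<Longrightarrow>
          (\<lambda>x'. F (x', w)) differentiable (at x) \<and>
          (\<lambda>x'. jacobian_x F (x', w)) differentiable (at x)"
    and f_strict: "\<And>\<nu> z. z \<in> U \<Longrightarrow> strictly_differentiable_at (f \<nu>) z"
    and F_strict: "\<And>z. z \<in> U \<Longrightarrow> strictly_differentiable_at F z"
    and grad_strict: "\<And>\<nu> z. z \<in> U \<Longrightarrow> strictly_differentiable_at (gradient_x (f \<nu>)) z"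
    and jac_strict: "\<And>z. z \<in> U \<Longrightarrow> strictly_differentiable_at (jacobian_x F) z"
  shows "isolated_calmness (S_Lag owner E f F) (wbar, 0, 0) (xbar, ybar) \<longleftrightarrow>
    (\<forall>(dx::real^'n) (dy::real^'m).
        G *v dx + transpose_rows_mult Jg \<alpha> dy + transpose_rows_mult Jg \<beta> dy = 0 \<and>
        (\<forall>i\<in>\<alpha>. (Jg *v dx) $ i = 0) \<and>
        complementary_on \<beta> (Jg *v dx) dy
      \<longrightarrow> dx = 0 \<and> (\<forall>i\<in>\<alpha> \<union> \<beta>. dy $ i = 0))"
proof -
  obtain A where A: "\<And>\<nu>. (gradient_x (f \<nu>) has_derivative A \<nu>) (at (xbar, wbar))"
    using strictly_differentiable_imp_has_derivative[OF grad_strict[OF nbhd(2)]] choice[of "\<lambda>\<nu> A. (gradient_x (f \<nu>) has_derivative A) (at (xbar, wbar))"]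
    by blast
  obtain B where B: "(jacobian_x F has_derivative B) (at (xbar, wbar))"
    using strictly_differentiable_imp_has_derivative[OF jac_strict[OF nbhd(2)]] by blast
  obtain F' where F': "(F has_derivative F') (at (xbar, wbar))"
    using strictly_differentiable_imp_has_derivative[OF F_strict[OF nbhd(2)]] by blast
  have Jg: "jacobian_x F (xbar, wbar) = Jg" "F' (dx, 0) = Jg *v dx" for dx
  proof -
    show "jacobian_x F (xbar, wbar) = Jg" by (simp add: jacobian_x_def Jg_def g_def)
    have "(g has_derivative (\<lambda>d. F' (d, 0))) (at xbar)"
      unfolding g_def by (rule has_derivative_fst_section[OF F'])
    then show "F' (dx, 0) = Jg *v dx"
      unfolding Jg_def
      by (metis differentiableI has_derivative_unique jacobian_works)
  qed
  have g: "g xbar \<in> normal_cone (polar_cone (constraint_cone E)) ybar"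
    using solution by (simp add: mem_S_Lag_iff g_def)
  have disjoint: "\<alpha> \<inter> \<beta> = {}"
    by (auto simp: \<alpha>_def \<beta>_def alpha_set_def beta_set_def)
  \<comment> \<open>Among the entries of \<open>dy\<close>, this condition involves only those in
    \<beta>, so changing the others preserves it.\<close>
  define K where "K dx dy \<longleftrightarrow> (\<forall>i\<in>\<alpha>. (Jg *v dx) $ i = 0) \<and> complementary_on \<beta> (Jg *v dx) dy" for dx dy
  have "(dx, dy) \<in> graphical_derivative (S_Lag owner E f F) (wbar, 0, 0) (xbar, ybar) 0 \<longleftrightarrow>
      G *v dx + transpose Jg *v dy = 0 \<and> K dx dy \<and> (\<forall>i. i \<notin> \<alpha> \<union> \<beta> \<longrightarrow> dy $ i = 0)" for dx dy
  proof -
    have G: "(G *v dx) $ i = A (owner i) (dx, 0) $ i + (transpose (B (dx, 0)) *v ybar) $ i" for i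
      unfolding G_def \<theta>_def g_def
      by (rule G_matrix_mult_vec[OF nbhd _ _ A B]) (use f_twice_diff F_twice_diff in auto)
    have "(\<chi> i. A (owner i) (dx, 0) $ i + (transpose Jg *v dy + transpose (B (dx, 0)) *v ybar) $ i)
        = G *v dx + transpose Jg *v dy"
      by (simp add: vec_eq_iff G)
    moreover have "(Jg *v dx, dy) \<in> critical_directions E (F (xbar, wbar)) ybar \<longleftrightarrow>
        K dx dy \<and> (\<forall>i. i \<notin> \<alpha> \<union> \<beta> \<longrightarrow> dy $ i = 0)"
      using mem_critical_directions_iff[of g xbar E ybar, OF g]
      by (simp add: g_def[symmetric] \<alpha>_def \<beta>_def K_def) (simp add: g_def)
    ultimately show ?thesis
      using graphical_derivative_complementarity_system[OF mem_S_Lag_iff solution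
        has_derivative_stationarity[OF A B] F', of dx dy]
      by (simp add: Jg)
  qed
  then have "isolated_calmness (S_Lag owner E f F) (wbar, 0, 0) (xbar, ybar) \<longleftrightarrow>
      (\<forall>dx dy. G *v dx + transpose Jg *v dy = 0 \<and> K dx dy \<and> (\<forall>i. i \<notin> \<alpha> \<union> \<beta> \<longrightarrow> dy $ i = 0)
        \<longrightarrow> dx = 0 \<and> dy = 0)"
    by (auto simp: isolated_calmness_iff_graphical_derivative subset_iff zero_prod_def)
  \<comment> \<open>It remains to pass from full vectors vanishing off \<alpha> and \<beta> to
    vectors whose entries there are arbitrary and ignored.\<close>
  also have "\<dots> \<longleftrightarrow> (\<forall>dx dy. G *v dx + transpose_rows_mult Jg \<alpha> dy + transpose_rows_mult Jg \<beta> dy = 0 \<and> K dx dy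
        \<longrightarrow> dx = 0 \<and> (\<forall>i\<in>\<alpha> \<union> \<beta>. dy $ i = 0))" (is "?full \<longleftrightarrow> ?sub")
  proof
    assume full: ?full
    show ?sub
    proof (intro allI impI)
      fix dx dy
      assume *: "G *v dx + transpose_rows_mult Jg \<alpha> dy + transpose_rows_mult Jg \<beta> dy = 0 \<and> K dx dy"
      \<comment> \<open>Erasing the ignored entries changes neither the row sums nor
        \<open>K\<close>, and makes \<open>dy'\<close> admissible for the full version.\<close>
      define dy' where "dy' = (\<chi> i. if i \<in> \<alpha> \<union> \<beta> then dy $ i else 0)"
      have off: "\<forall>i. i \<notin> \<alpha> \<union> \<beta> \<longrightarrow> dy' $ i = 0" by (simp add: dy'_def)
      have "transpose_rows_mult Jg I dy' = transpose_rows_mult Jg I dy" if "I \<subseteq> \<alpha> \<union> \<beta>" for I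
        unfolding transpose_rows_mult_def by (rule sum.cong) (use that in \<open>auto simp: dy'_def\<close>)
      then have "G *v dx + transpose Jg *v dy' = 0"
        using * transpose_rows_mult_union[OF disjoint, of dy' Jg] off by (simp add: add.assoc)
      moreover have "K dx dy'"
        using * by (simp add: K_def complementary_on_iff dy'_def)
      ultimately have "dx = 0 \<and> dy' = 0" using full off by blast
      then show "dx = 0 \<and> (\<forall>i\<in>\<alpha> \<union> \<beta>. dy $ i = 0)"
        by (auto simp: dy'_def vec_eq_iff split: if_splits)
    qed
  next
    assume sub: ?sub
    show ?full
    proof (intro allI impI)
      fix dx dy
      assume *: "G *v dx + transpose Jg *v dy = 0 \<and> K dx dy \<and> (\<forall>i. i \<notin> \<alpha> \<union> \<beta> \<longrightarrow> dy $ i = 0)"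
      then have "G *v dx + transpose_rows_mult Jg \<alpha> dy + transpose_rows_mult Jg \<beta> dy = 0"
        using transpose_rows_mult_union[OF disjoint, of dy Jg] by (simp add: add.assoc)
      then have "dx = 0 \<and> (\<forall>i\<in>\<alpha> \<union> \<beta>. dy $ i = 0)" using sub * by blast
      then show "dx = 0 \<and> dy = 0" using * by (metis vec_eq_iff zero_index)
    qed
  qed
  finally show ?thesis by (simp only: K_def)
qed

end
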